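(* For $n = 2$ and for $n = 3$, the configuration of $n$ equidistributed points on $\mathbb{T}$ does not minimize the norm of simple partial fractions of degree $2$ in $A^2_3$: there exist distinct points $a_0, \ldots, a_{n-1} \in \mathbb{T}$ such that $$\Big\| \sum_{k=0}^{n-1} \frac{1}{(z-a_k)^2} \Big\|_3 < \Big\| \sum_{k=0}^{n-1} \frac{1}{(z-e^{2\pi i k/n})^2} \Big\|_3 .$$
   Context: $\mathbb{D}$ is the open unit disc, $\mathbb{T}$ the unit circle. For $f$ holomorphic on $\mathbb{D}$, $\|f\|_3^2 = 4\int_{\mathbb{D}} |f(z)|^2 (1-|z|^2)^3 \, dA(z)$, where $dA$ is Lebesgue area measure normalized so that $\mathbb{D}$ has measure $1$; $A^2_3$ is the space of such $f$ with finite norm. *)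

theory Defs
  imports "HOL-Complex_Analysis.Complex_Analysis"
begin

definition weight3_density :: "(complex \<Rightarrow> complex) \<Rightarrow> complex \<Rightarrow> real" where
  "weight3_density f z = (cmod (f z))\<^sup>2 * (1 - (cmod z)\<^sup>2) ^ 3"

definition A23 :: "(complex \<Rightarrow> complex) set" where
  "A23 = {f. f holomorphic_on ball 0 1 \<and> set_integrable lebesgue (ball 0 1) (weight3_density f)}"

(* The area measure is normalised so that the unit disc, whose Lebesgue area is pi, has
   measure 1; hence the factor 4 / pi. The value is meaningful only for f in A23, since the
   integral of a non-integrable function is 0. *)
definition norm3 :: "(complex \<Rightarrow> complex) \<Rightarrow> real" where
  "norm3 f = sqrt (4 / pi * set_lebesgue_integral lebesgue (ball 0 1) (weight3_density f))"

definition simple_partial_fraction2 :: "nat \<Rightarrow> (nat \<Rightarrow> complex) \<Rightarrow> complex \<Rightarrow> complex" where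
  "simple_partial_fraction2 n a z = (\<Sum>k<n. 1 / (z - a k)\<^sup>2)"

definition equidistributed :: "nat \<Rightarrow> nat \<Rightarrow> complex" where
  "equidistributed n k = exp (2 * complex_of_real pi * \<i> * of_nat k / of_nat n)"

end

theory Submission
  imports Defs
begin

text \<open>
  Rotation invariance makes the monomials orthogonal for the weight, so a configuration with power
  sums \<open>S\<^sub>j = (\<Sum>k<n. a k ^ j)\<close> has squared norm \<open>24 * (\<Sum>m. c m * (cmod S\<^sub>j)\<^sup>2)\<close>, where \<open>j = m + 2\<close>
  and \<open>c m = (m + 1) / ((m + 2) * (m + 3) * (m + 4))\<close>.
  For the equidistributed points \<open>S\<^sub>j\<close> is \<open>n\<close> or \<open>0\<close> according to whether \<open>n\<close> divides \<open>j\<close>. They are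
  beaten by \<open>1, \<i>\<close> and by \<open>1, \<i>, -\<i>\<close> respectively: the difference of the two series has periodic
  coefficients against \<open>c\<close>, and it is positive because \<open>c\<close> is decreasing and convex.
\<close>

section \<open>Rotation invariance of planar Lebesgue measure\<close>

text \<open>A box in the complex plane is a product of real intervals, and its measure determines
  \<open>lborel\<close>. This gives access to Fubini in the coordinates \<open>Re\<close> and
  \<open>Im\<close>.\<close>

lemma lborel_complex_eq:
  "(lborel :: complex measure) = distr (lborel \<Otimes>\<^sub>M lborel) borel (\<lambda>(x, y). Complex x y)"
proof (rule lborel_eqI)
  fix l u :: complex
  assume le: "\<And>b. b \<in> Basis \<Longrightarrow> l \<bullet> b \<le> u \<bullet> b"
  have [measurable]: "(\<lambda>(x, y). Complex x y) \<in> borel_measurable (lborel \<Otimes>\<^sub>M lborel)"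
    unfolding Complex_eq by measurable
  have "Re l \<le> Re u" "Im l \<le> Im u"
    using le[of 1] le[of \<i>] by (auto simp: Basis_complex_def)
  moreover have "(\<lambda>(x, y). Complex x y) -` box l u = {Re l<..<Re u} \<times> {Im l<..<Im u}"
    by (auto simp: in_box_complex_iff)
  ultimately show "emeasure (distr (lborel \<Otimes>\<^sub>M lborel) borel (\<lambda>(x, y). Complex x y)) (box l u)
      = (\<Prod>b\<in>Basis. (u - l) \<bullet> b)"
    by (subst emeasure_distr)
       (auto simp: space_pair_measure lborel.emeasure_pair_measure_Times Basis_complex_def ennreal_mult)
qed auto

text \<open>Both orders are recorded because a horizontal shear acts on the inner variable
  \<open>x\<close>, a vertical one on the inner variable \<open>y\<close>.\<close>

lemma nn_integral_lborel_complex: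
  assumes [measurable]: "f \<in> borel_measurable borel"
  shows "(\<integral>\<^sup>+z. f z \<partial>lborel) = (\<integral>\<^sup>+x. \<integral>\<^sup>+y. f (Complex x y) \<partial>lborel \<partial>lborel)"
    and "(\<integral>\<^sup>+z. f z \<partial>lborel) = (\<integral>\<^sup>+y. \<integral>\<^sup>+x. f (Complex x y) \<partial>lborel \<partial>lborel)"
proof -
  have [measurable]: "(\<lambda>(x, y). Complex x y) \<in> borel_measurable (lborel \<Otimes>\<^sub>M lborel)"
    unfolding Complex_eq by measurable
  have "(\<integral>\<^sup>+z. f z \<partial>lborel) = (\<integral>\<^sup>+p. f (case p of (x, y) \<Rightarrow> Complex x y) \<partial>(lborel \<Otimes>\<^sub>M lborel))"
    by (subst lborel_complex_eq, subst nn_integral_distr) auto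
  then show "(\<integral>\<^sup>+z. f z \<partial>lborel) = (\<integral>\<^sup>+x. \<integral>\<^sup>+y. f (Complex x y) \<partial>lborel \<partial>lborel)"
    by (subst (asm) lborel.nn_integral_fst[symmetric]) auto
  then show "(\<integral>\<^sup>+z. f z \<partial>lborel) = (\<integral>\<^sup>+y. \<integral>\<^sup>+x. f (Complex x y) \<partial>lborel \<partial>lborel)"
    by (subst lborel_pair.Fubini') (auto simp: case_prod_unfold Complex_eq)
qed

text \<open>With the other coordinate held fixed, a shear is a translation of the inner real
  variable.\<close>

lemma nn_integral_lborel_shear:
  fixes f :: "complex \<Rightarrow> ennreal" and t :: real
  assumes [measurable]: "f \<in> borel_measurable borel"
  shows "(\<integral>\<^sup>+z. f (Complex (Re z + t * Im z) (Im z)) \<partial>lborel) = (\<integral>\<^sup>+z. f z \<partial>lborel)"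
    and "(\<integral>\<^sup>+z. f (Complex (Re z) (Im z + t * Re z)) \<partial>lborel) = (\<integral>\<^sup>+z. f z \<partial>lborel)"
proof -
  have [measurable]: "(\<lambda>z. f (Complex (Re z + t * Im z) (Im z))) \<in> borel_measurable borel"
    "(\<lambda>z. f (Complex (Re z) (Im z + t * Re z))) \<in> borel_measurable borel"
    unfolding Complex_eq by measurable
  have [measurable]: "(\<lambda>x. f (Complex x y)) \<in> borel_measurable borel"
    "(\<lambda>x. f (Complex y x)) \<in> borel_measurable borel" for y
    unfolding Complex_eq by measurable
  have "(\<integral>\<^sup>+x. f (Complex (x + t * y) y) \<partial>lborel) = (\<integral>\<^sup>+x. f (Complex x y) \<partial>lborel)" for y
    using nn_integral_real_affine[of "\<lambda>x. f (Complex x y)" 1 "t * y"] by (simp add: add.commute)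
  then show "(\<integral>\<^sup>+z. f (Complex (Re z + t * Im z) (Im z)) \<partial>lborel) = (\<integral>\<^sup>+z. f z \<partial>lborel)"
    by (simp add: nn_integral_lborel_complex(2))
  have "(\<integral>\<^sup>+y. f (Complex x (y + t * x)) \<partial>lborel) = (\<integral>\<^sup>+y. f (Complex x y) \<partial>lborel)" for x
    using nn_integral_real_affine[of "\<lambda>y. f (Complex x y)" 1 "t * x"] by (simp add: add.commute)
  then show "(\<integral>\<^sup>+z. f (Complex (Re z) (Im z + t * Re z)) \<partial>lborel) = (\<integral>\<^sup>+z. f z \<partial>lborel)"
    by (simp add: nn_integral_lborel_complex(1))
qed

text \<open>A rotation by an angle other than \<open>\<pi>\<close> is a product of three shears.\<close>

lemma nn_integral_lborel_rotate:
  fixes f :: "complex \<Rightarrow> ennreal"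
  assumes [measurable]: "f \<in> borel_measurable borel" and w: "cmod w = 1" "w \<noteq> -1"
  shows "(\<integral>\<^sup>+z. f (w * z) \<partial>lborel) = (\<integral>\<^sup>+z. f z \<partial>lborel)"
proof -
  define s where "s = Im w"
  \<comment> \<open>For \<open>w = cis\<close> of an angle, \<open>s\<close> is its sine and
    \<open>t\<close> is minus the tangent of half of it. The denominator vanishes on the unit circle
    only at -1.\<close>
  define t where "t = - Im w / (1 + Re w)"
  have sq: "(Re w)\<^sup>2 + s\<^sup>2 = 1"
    using w(1) by (simp add: cmod_def s_def)
  have ne: "1 + Re w \<noteq> 0"
  proof
    assume "1 + Re w = 0"
    then have "Re w = -1" by simp
    with sq have "s = 0" by simp
    with \<open>Re w = -1\<close> w(2) show False by (simp add: s_def complex_eq_iff)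
  qed
  have ts: "1 + t * s = Re w"
  proof -
    have "(1 + t * s) * (1 + Re w) = 1 + Re w - s\<^sup>2"
      using ne by (simp add: t_def s_def field_simps power2_eq_square)
    also have "\<dots> = Re w * (1 + Re w)"
      using sq by (simp add: power2_eq_square algebra_simps)
    finally show ?thesis using ne by simp
  qed
  have tt: "t * (1 + Re w) = - s"
    using ne by (simp add: t_def s_def)
  define H where "H = (\<lambda>z. Complex (Re z + t * Im z) (Im z))"
  define V where "V = (\<lambda>z. Complex (Re z) (Im z + s * Re z))"
  have [measurable]: "H \<in> borel_measurable borel" "V \<in> borel_measurable borel"
    unfolding H_def V_def Complex_eq by measurable
  have H: "Complex (Re z + t * Im z) (Im z) = H z" and V: "Complex (Re z) (Im z + s * Re z) = V z" for z
    by (simp_all add: H_def V_def)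
  have "w * z = H (V (H z))" for z
  proof -
    have "Re z * (1 + t * s) + (t + (1 + t * s) * t) * Im z = Re z * Re w - s * Im z"
      using tt unfolding ts by (simp add: algebra_simps)
    moreover have "Im z * (1 + t * s) + s * Re z = Im z * Re w + s * Re z"
      unfolding ts ..
    ultimately show ?thesis
      by (simp add: H_def V_def complex_eq_iff s_def[symmetric] algebra_simps)
  qed
  then have "(\<integral>\<^sup>+z. f (w * z) \<partial>lborel) = (\<integral>\<^sup>+z. f (H (V (H z))) \<partial>lborel)"
    by simp
  \<comment> \<open>The shears are removed from the innermost outwards, the remaining ones being
    absorbed into the integrand.\<close>
  also have "\<dots> = (\<integral>\<^sup>+z. f (H (V z)) \<partial>lborel)"
    using nn_integral_lborel_shear(1)[of "\<lambda>z. f (H (V z))" t] by (simp add: H)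
  also have "\<dots> = (\<integral>\<^sup>+z. f (H z) \<partial>lborel)"
    using nn_integral_lborel_shear(2)[of "\<lambda>z. f (H z)" s] by (simp add: V)
  also have "\<dots> = (\<integral>\<^sup>+z. f z \<partial>lborel)"
    using nn_integral_lborel_shear(1)[of f t] by (simp add: H)
  finally show ?thesis .
qed

text \<open>As an identity of measures, invariance also transfers to complex-valued Bochner
  integrals, for measurable integrands.\<close>

lemma distr_lborel_rotate:
  assumes "cmod w = 1" "w \<noteq> -1"
  shows "distr lborel borel ((*) w) = lborel"
proof (rule measure_eqI)
  fix A :: "complex set"
  assume "A \<in> sets (distr lborel borel ((*) w))"
  then have [measurable]: "A \<in> sets borel" by simp
  have "emeasure (distr lborel borel ((*) w)) A = (\<integral>\<^sup>+z. indicator A (w * z) \<partial>lborel)"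
    by (subst nn_integral_indicator[symmetric], simp, subst nn_integral_distr) auto
  also have "\<dots> = emeasure lborel A"
    by (subst nn_integral_lborel_rotate[OF _ assms]) auto
  finally show "emeasure (distr lborel borel ((*) w)) A = emeasure lborel A" .
qed simp

section \<open>Orthogonality of monomials for radial weights\<close>

lemma borel_measurable_cnj [measurable]: "cnj \<in> borel_measurable borel"
  by (intro borel_measurable_continuous_onI continuous_intros)

text \<open>Rotating by \<open>w\<close> multiplies the integrand by \<open>w ^ (m - n)\<close>, so
  the integral equals itself times a number other than 1. Integrability is not at issue: the
  integral of a nonintegrable function is 0 by convention.\<close>

lemma integral_power_mult_cnj_power_eq_0:
  fixes h :: "real \<Rightarrow> real"
  assumes [measurable]: "h \<in> borel_measurable borel" and "m \<noteq> n"
  shows "(\<integral>z. complex_of_real (h (cmod z)) * (z ^ m * cnj z ^ n) \<partial>lborel) = 0"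
  using \<open>m \<noteq> n\<close>
proof (induction n m rule: linorder_wlog)
  case (le n m)
  \<comment> \<open>The angle makes \<open>w ^ (m - n) = cis 1\<close>, which is not real. This
    rules out both \<open>w ^ (m - n) = 1\<close> and the excluded rotation by -1, all of whose
    powers are real.\<close>
  define w where "w = cis (1 / real (m - n))"
  define I where "I = (\<integral>z. complex_of_real (h (cmod z)) * (z ^ m * cnj z ^ n) \<partial>lborel)"
  have k: "m - n > 0" using le by simp
  have w: "cmod w = 1" by (simp add: w_def)
  have "w ^ (m - n) = cis (real (m - n) * (1 / real (m - n)))"
    by (simp only: w_def Complex.DeMoivre)
  also have "\<dots> = cis 1"
    using k by (simp del: of_nat_diff)
  finally have w1: "w ^ (m - n) = cis 1" .
  have sin1: "sin (1::real) \<noteq> 0"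
    using sin_gt_zero[of 1] pi_gt3 by simp
  then have wk: "w ^ (m - n) \<noteq> 1"
    unfolding w1 by (auto simp: complex_eq_iff)
  have wn: "w \<noteq> -1"
  proof
    assume "w = -1"
    then have "w ^ (m - n) \<in> \<real>" by simp
    with w1 sin1 show False by (simp add: complex_is_Real_iff)
  qed
  have "cnj w * w = 1"
    using w by (simp add: complex_norm_square[symmetric] mult.commute)
  moreover have "w ^ m = w ^ (m - n) * w ^ n"
    using le(1) by (simp flip: power_add)
  then have "w ^ m * cnj w ^ n = w ^ (m - n) * (cnj w * w) ^ n"
    by (simp add: power_mult_distrib mult_ac)
  ultimately have cw: "w ^ m * cnj w ^ n = w ^ (m - n)"
    by simp
  have "I = (\<integral>z. complex_of_real (h (cmod z)) * (z ^ m * cnj z ^ n) \<partial>(distr lborel borel ((*) w)))"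
    by (simp add: I_def distr_lborel_rotate[OF w wn])
  also have "\<dots> = (\<integral>z. complex_of_real (h (cmod (w * z))) * ((w * z) ^ m * cnj (w * z) ^ n) \<partial>lborel)"
    by (subst integral_distr) auto
  also have "\<dots> = (\<integral>z. w ^ (m - n) * (complex_of_real (h (cmod z)) * (z ^ m * cnj z ^ n)) \<partial>lborel)"
    by (intro Bochner_Integration.integral_cong refl)
       (simp add: norm_mult w cw[symmetric] power_mult_distrib mult_ac)
  also have "\<dots> = w ^ (m - n) * I"
    by (simp add: I_def)
  finally have "(1 - w ^ (m - n)) * I = 0"
    by (simp add: algebra_simps)
  with wk have "I = 0" by simp
  then show ?case by (simp add: I_def)
next
  case (sym n m)
  have "(\<integral>z. complex_of_real (h (cmod z)) * (z ^ m * cnj z ^ n) \<partial>lborel) = 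
     (\<integral>z. cnj (complex_of_real (h (cmod z)) * (z ^ n * cnj z ^ m)) \<partial>lborel)"
    by (simp add: mult_ac)
  also have "\<dots> = cnj (\<integral>z. complex_of_real (h (cmod z)) * (z ^ n * cnj z ^ m) \<partial>lborel)"
    by (rule Bochner_Integration.integral_cnj)
  finally show ?case using sym by simp
qed

section \<open>Radial integrals and moments of the weight\<close>

text \<open>The squared modulus of a uniformly distributed point of the disc is uniformly distributed.\<close>

lemma nn_integral_ball_radial:
  fixes g :: "real \<Rightarrow> ennreal"
  assumes [measurable]: "g \<in> borel_measurable borel"
  shows "(\<integral>\<^sup>+z\<in>ball 0 1. g ((cmod z)\<^sup>2) \<partial>lborel) = ennreal pi * (\<integral>\<^sup>+t\<in>{0..1}. g t \<partial>lborel)"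
proof -
  have [measurable]: "ball (0::complex) 1 \<in> sets borel"
    by simp
  \<comment> \<open>\<open>M\<close> is the law of the squared modulus under area measure on the
    disc, \<open>N\<close> is \<open>pi\<close> times Lebesgue measure on the unit interval. They
    are identified by their values on the half-lines \<open>{x<..}\<close>.\<close>
  define M where "M = distr (density lborel (indicator (ball 0 1))) borel (\<lambda>z :: complex. (cmod z)\<^sup>2)"
  define N where "N = density lborel (\<lambda>t::real. ennreal pi * indicator {0..1} t)"
  have M: "emeasure M {x<..} = ennreal (if x < 0 then pi else if x \<le> 1 then pi * (1 - x) else 0)" for x
  proof -
    have "emeasure M {x<..} = emeasure lborel (ball (0::complex) 1 \<inter> {z. x < (cmod z)\<^sup>2})"
      unfolding M_def
      by (subst emeasure_distr) (auto simp: emeasure_restricted vimage_def)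
    also have "ball (0::complex) 1 \<inter> {z. x < (cmod z)\<^sup>2} =
        (if x < 0 then ball 0 1 else ball 0 1 - cball 0 (sqrt x))"
    proof (cases "x < 0")
      case True
      then show ?thesis
        by (auto intro: less_le_trans[OF _ zero_le_power2])
    next
      case False
      then show ?thesis
        by (auto simp: not_le real_sqrt_less_iff[symmetric, of x "_\<^sup>2"])
    qed
    also have "emeasure lborel \<dots> = ennreal (if x < 0 then pi else if x \<le> 1 then pi * (1 - x) else 0)"
    proof -
      consider "x < 0" | "0 \<le> x" "x \<le> 1" | "x > 1" by linarith
      then show ?thesis
      proof cases
        case 2
        \<comment> \<open>At \<open>x = 1\<close> the closed disc is not contained in the open one,
          but the set difference is then empty.\<close>
        have "cball 0 (sqrt x) \<subseteq> ball (0::complex) 1" if "x \<noteq> 1"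
        proof
          fix z :: complex assume "z \<in> cball 0 (sqrt x)"
          moreover have "sqrt x < 1" using 2 that by simp
          ultimately show "z \<in> ball 0 1"
            by (metis dist_0_norm le_less_trans mem_ball mem_cball)
        qed
        then have "cball 0 (sqrt x) \<subseteq> ball (0::complex) 1 \<or> x = 1"
          by blast
        then show ?thesis
        proof
          assume "cball 0 (sqrt x) \<subseteq> ball (0::complex) 1"
          then have "emeasure lborel (ball (0::complex) 1 - cball 0 (sqrt x)) =
              emeasure lborel (ball (0::complex) 1) - emeasure lborel (cball (0::complex) (sqrt x))"
            by (intro emeasure_Diff) (auto simp: emeasure_cball unit_ball_vol_2 2)
          then show ?thesis
            using 2 by (simp add: emeasure_cball emeasure_ball unit_ball_vol_2 ennreal_minus right_diff_distrib)
        next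
          assume x: "x = 1"
          then have *: "ball (0::complex) 1 - cball 0 (sqrt x) = {}" by auto
          show ?thesis unfolding * using x by simp
        qed
      next
        case 3
        then have "1 < sqrt x" by simp
        then have "cmod z \<le> sqrt x" if "cmod z < 1" for z
          using that by linarith
        then have *: "ball (0::complex) 1 - cball 0 (sqrt x) = {}" by auto
        show ?thesis unfolding * using 3 by simp
      qed (auto simp: emeasure_ball unit_ball_vol_2)
    qed
    finally show ?thesis .
  qed
  have N: "emeasure N {x<..} = ennreal (if x < 0 then pi else if x \<le> 1 then pi * (1 - x) else 0)" for x
  proof -
    have "emeasure N {x<..} = ennreal pi * emeasure lborel ({0..1} \<inter> {x<..})"
      unfolding N_def
      by (subst emeasure_density)
         (auto simp: mult.assoc nn_integral_cmult indicator_inter_arith[symmetric])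
    also have "{0..1} \<inter> {x<..} = (if x < 0 then {0..1} else {x<..1})"
      by auto
    finally show ?thesis
      by (auto simp: ennreal_mult'[symmetric])
  qed
  have "M = N"
    by (rule measure_eqI_lessThan) (auto simp: M N, auto simp: M_def N_def)
  have "(\<integral>\<^sup>+z\<in>ball 0 1. g ((cmod z)\<^sup>2) \<partial>lborel) = (\<integral>\<^sup>+t. g t \<partial>M)"
    unfolding M_def by (subst nn_integral_distr, simp, simp, subst nn_integral_density) (auto simp: mult.commute)
  also have "\<dots> = ennreal pi * (\<integral>\<^sup>+t\<in>{0..1}. g t \<partial>lborel)"
    unfolding \<open>M = N\<close> N_def
    by (subst nn_integral_density) (auto simp: nn_integral_cmult[symmetric] mult_ac)
  finally show ?thesis .
qed

text \<open>With \<open>t\<close> the squared modulus this is \<open>pi\<close> times the Beta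
  integral of \<open>t ^ m * (1 - t) ^ 3\<close>. The antiderivative comes from expanding the
  cube.\<close>

lemma nn_integral_ball_moment:
  "(\<integral>\<^sup>+z\<in>ball (0::complex) 1. ennreal ((cmod z) ^ (2 * m) * (1 - (cmod z)\<^sup>2) ^ 3) \<partial>lborel)
    = ennreal (6 * pi / ((real m + 1) * (real m + 2) * (real m + 3) * (real m + 4)))"
proof -
  define G where "G = (\<lambda>k (t::real). t ^ Suc k / Suc k)"
  have G: "(G k has_real_derivative t ^ k) (at t)" for k t
    using DERIV_cdivide[OF DERIV_pow[of "Suc k" t], of "real (Suc k)"] unfolding G_def
    by (simp del: of_nat_Suc)
  define F where "F = (\<lambda>t. G m t - 3 * G (m+1) t + 3 * G (m+2) t - G (m+3) t)"
  have "(\<integral>\<^sup>+z\<in>ball (0::complex) 1. ennreal ((cmod z) ^ (2 * m) * (1 - (cmod z)\<^sup>2) ^ 3) \<partial>lborel)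
     = ennreal pi * (\<integral>\<^sup>+t\<in>{0..1}. ennreal (t ^ m * (1 - t) ^ 3) \<partial>lborel)"
    using nn_integral_ball_radial[of "\<lambda>t. ennreal (t ^ m * (1 - t) ^ 3)"] by (simp add: power_mult)
  also have "(\<integral>\<^sup>+t\<in>{0..1}. ennreal (t ^ m * (1 - t) ^ 3) \<partial>lborel) = ennreal (F 1 - F 0)"
  proof (rule nn_integral_FTC_Icc)
    fix t :: real
    have "(F has_real_derivative t ^ m - 3 * t ^ (m+1) + 3 * t ^ (m+2) - t ^ (m+3)) (at t)"
      unfolding F_def by (rule derivative_eq_intros G refl)+ simp
    also have "t ^ m - 3 * t ^ (m+1) + 3 * t ^ (m+2) - t ^ (m+3) = t ^ m * (1 - t) ^ 3"
      by (simp add: power_add power3_eq_cube power2_eq_square algebra_simps)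
    finally show "(F has_real_derivative t ^ m * (1 - t) ^ 3) (at t)" .
  qed auto
  also have "F 1 - F 0 = 6 / ((real m + 1) * (real m + 2) * (real m + 3) * (real m + 4))"
  proof -
    have "1 / (x + 1) - 3 / (x + 2) + 3 / (x + 3) - 1 / (x + 4) = 6 / ((x + 1) * (x + 2) * (x + 3) * (x + 4))"
      if "x \<ge> 0" for x :: real
    proof -
      have "x + 1 \<noteq> 0" "x + 2 \<noteq> 0" "x + 3 \<noteq> 0" "x + 4 \<noteq> 0"
        using that by auto
      then show ?thesis
        by (simp add: divide_simps) (simp add: algebra_simps)
    qed
    note frac = this[of "real m"]
    have "F 1 - F 0 = 1 / (real m + 1) - 3 / (real m + 2) + 3 / (real m + 3) - 1 / (real m + 4)"
      by (simp add: F_def G_def add_ac)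
    also have "\<dots> = 6 / ((real m + 1) * (real m + 2) * (real m + 3) * (real m + 4))"
      by (rule frac) simp
    finally show ?thesis .
  qed
  also have "ennreal pi * ennreal \<dots> = ennreal (6 * pi / ((real m + 1) * (real m + 2) * (real m + 3) * (real m + 4)))"
    by (subst ennreal_mult[symmetric]) (auto simp: mult_ac)
  finally show ?thesis .
qed

section \<open>The weighted norm in terms of Taylor coefficients\<close>

text \<open>The radius is less than 1 because on the whole disc the partial sums of \<open>f\<close> need not have an
  integrable majorant.\<close>

lemma nn_integral_power_series_ball:
  fixes u :: "nat \<Rightarrow> complex" and f :: "complex \<Rightarrow> complex"
  assumes [measurable]: "f \<in> borel_measurable borel"
    and f: "\<And>z. cmod z < 1 \<Longrightarrow> (\<lambda>m. u m * z ^ m) sums f z"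
    and r: "0 < r" "r < 1"
    and h: "\<And>x. 0 \<le> x \<Longrightarrow> x < 1 \<Longrightarrow> 0 \<le> h x \<and> h x \<le> (1::real)"
    and [measurable]: "h \<in> borel_measurable borel"
  shows "(\<integral>\<^sup>+z\<in>ball 0 r. ennreal ((cmod (f z))\<^sup>2 * h (cmod z)) \<partial>lborel)
    = (\<Sum>m. ennreal ((cmod (u m))\<^sup>2) * (\<integral>\<^sup>+z\<in>ball (0::complex) r. ennreal (cmod z ^ (2 * m) * h (cmod z)) \<partial>lborel))"
proof -
  define P where "P = (\<lambda>N z. \<Sum>m<N. u m * z ^ m)"
  define C where "C = (\<Sum>m. cmod (u m) * r ^ m)"
  \<comment> \<open>Cutting the weight off at \<open>r\<close> turns integrals over the disc into
    integrals over the plane against a radial function, as orthogonality requires.\<close>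
  define k where "k = (\<lambda>x. if x < r then h x else 0)"
  define I where "I = (\<lambda>m. \<integral>z. k (cmod z) * cmod z ^ (2 * m) \<partial>(lborel :: complex measure))"
  have [measurable]: "k \<in> borel_measurable borel" "\<And>N. P N \<in> borel_measurable borel"
    unfolding k_def P_def by measurable
  have k: "0 \<le> k (cmod z)" "k (cmod z) \<le> indicator (ball 0 r) z" for z
    using h[of "cmod z"] r by (auto simp: k_def)
  have hk: "ennreal (c * h (cmod z)) * indicator (ball 0 r) z = ennreal (c * k (cmod z))" for c z
    by (auto simp: k_def indicator_def)
  have summ: "summable (\<lambda>m. cmod (u m) * r ^ m)"
  proof -
    \<comment> \<open>Convergence at a point \<open>s\<close> beyond \<open>r\<close> gives absolute
      convergence at \<open>r\<close>, so \<open>C\<close> bounds all partial sums on the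
      disc.\<close>
    obtain s where s: "r < s" "s < 1" using r dense by blast
    have "summable (\<lambda>m. u m * complex_of_real s ^ m)"
      using f[of "complex_of_real s"] s r by (simp add: sums_iff)
    then have "summable (\<lambda>m. norm (u m * complex_of_real r ^ m))"
      by (rule powser_insidea) (use s r in auto)
    then show ?thesis using r by (simp add: norm_mult norm_power)
  qed
  have bound: "cmod (P N z) \<le> C" if "cmod z < r" for N z
  proof -
    have "cmod (P N z) \<le> (\<Sum>m<N. cmod (u m) * r ^ m)"
      unfolding P_def using that
      by (intro order.trans[OF norm_sum] sum_mono)
         (auto simp: norm_mult norm_power intro!: mult_left_mono power_mono)
    also have "\<dots> \<le> C"
      unfolding C_def using summ r by (intro sum_le_suminf) auto
    finally show ?thesis .
  qed
  have [measurable]: "ball (0::complex) r \<in> sets borel"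
    by simp
  have intg: "integrable lborel (\<lambda>z::complex. complex_of_real (k (cmod z)) * (z ^ m * cnj z ^ n))" for m n
  proof (rule Bochner_Integration.integrable_bound)
    show "integrable lborel (indicator (ball 0 r) :: complex \<Rightarrow> real)"
      using emeasure_lborel_ball_finite[of "0::complex" r] by (intro integrable_real_indicator) auto
    show "AE z in lborel. norm (complex_of_real (k (cmod z)) * (z ^ m * cnj z ^ n))
        \<le> norm (indicator (ball 0 r) z :: real)"
    proof (rule AE_I2)
      fix z :: complex
      show "norm (complex_of_real (k (cmod z)) * (z ^ m * cnj z ^ n)) \<le> norm (indicator (ball 0 r) z :: real)"
      proof (cases "cmod z < r")
        case True
        then have "cmod z ^ m * cmod z ^ n \<le> 1"
          using r by (intro mult_le_one power_le_one) auto
        then have "k (cmod z) * (cmod z ^ m * cmod z ^ n) \<le> 1"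
          using k[of z] True by (intro mult_le_one[of "k (cmod z)"]) auto
        then show ?thesis
          using True k(1)[of z] by (simp add: norm_mult norm_power)
      qed (simp add: k_def)
    qed
  qed simp
  have diag: "complex_of_real (k (cmod z)) * (z ^ m * cnj z ^ m) = complex_of_real (k (cmod z) * cmod z ^ (2 * m))" for z m
  proof -
    have "z ^ m * cnj z ^ m = (z * cnj z) ^ m"
      by (rule power_mult_distrib[symmetric])
    then show ?thesis
      by (simp add: complex_norm_square[symmetric] power_mult)
  qed
  have intI: "integrable lborel (\<lambda>z::complex. k (cmod z) * cmod z ^ (2 * m))" for m
    using integrable_Re[OF intg[of m m]] unfolding diag by simp
  have inner: "(\<integral>z. complex_of_real (k (cmod z)) * (z ^ m * cnj z ^ n) \<partial>lborel)
      = (if m = n then complex_of_real (I m) else 0)" for m n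
    by (auto simp: integral_power_mult_cnj_power_eq_0 diag I_def simp del: of_real_mult)
  have expand: "complex_of_real ((cmod (P N z))\<^sup>2 * k (cmod z))
      = (\<Sum>m<N. \<Sum>n<N. u m * cnj (u n) * (complex_of_real (k (cmod z)) * (z ^ m * cnj z ^ n)))" for N z
  proof -
    have sq: "P N z * cnj (P N z) = (\<Sum>m<N. \<Sum>n<N. (u m * z ^ m) * (cnj (u n) * cnj z ^ n))"
      unfolding P_def cnj_sum sum_product by simp
    show ?thesis
      unfolding of_real_mult complex_norm_square sq sum_distrib_right
      by (intro sum.cong refl) (simp add: mult_ac)
  qed
  have intP: "integrable lborel (\<lambda>z. (cmod (P N z))\<^sup>2 * k (cmod z))" for N
  proof -
    have "integrable lborel (\<lambda>z. complex_of_real ((cmod (P N z))\<^sup>2 * k (cmod z)))"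
      unfolding expand by (intro Bochner_Integration.integrable_sum integrable_mult_right intg)
    then show ?thesis by (rule complex_of_real_integrable_eq[THEN iffD1])
  qed
  have "(\<integral>z. (cmod (P N z))\<^sup>2 * k (cmod z) \<partial>lborel) = (\<Sum>m<N. (cmod (u m))\<^sup>2 * I m)" for N
  proof -
    have "complex_of_real (\<integral>z. (cmod (P N z))\<^sup>2 * k (cmod z) \<partial>lborel)
        = (\<integral>z. complex_of_real ((cmod (P N z))\<^sup>2 * k (cmod z)) \<partial>lborel)"
      by (rule integral_complex_of_real[symmetric])
    also have "\<dots> = (\<Sum>m<N. \<Sum>n<N. u m * cnj (u n) * (if m = n then complex_of_real (I m) else 0))"
      unfolding expand
      by (simp add: intg inner)
    also have "\<dots> = (\<Sum>m<N. complex_of_real ((cmod (u m))\<^sup>2 * I m))"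
      by (intro sum.cong refl) (simp add: if_distrib complex_norm_square[symmetric] cong: if_cong)
    finally show ?thesis
      unfolding of_real_sum[symmetric] of_real_eq_iff .
  qed
  then have PN: "(\<integral>\<^sup>+z. ennreal ((cmod (P N z))\<^sup>2 * k (cmod z)) \<partial>lborel) = (\<Sum>m<N. ennreal ((cmod (u m))\<^sup>2) * ennreal (I m))" for N
    using intP k(1)
    by (subst nn_integral_eq_integral)
       (auto simp: I_def ennreal_mult'[symmetric] intro!: sum_ennreal[symmetric] mult_nonneg_nonneg integral_nonneg)
  have Im: "ennreal (I m) = (\<integral>\<^sup>+z\<in>ball (0::complex) r. ennreal (cmod z ^ (2 * m) * h (cmod z)) \<partial>lborel)" for m
    unfolding hk I_def using intI[of m] k(1)
    by (subst nn_integral_eq_integral[symmetric]) (auto simp: mult.commute)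
  \<comment> \<open>The left-hand integrals are, by \<open>PN\<close>, the partial sums of the
    claimed series. The squares of the \<open>P N\<close> are dominated by the constant
    \<open>C\<^sup>2\<close> on the disc.\<close>
  have "(\<lambda>N. \<integral>\<^sup>+z. ennreal ((cmod (P N z))\<^sup>2 * k (cmod z)) \<partial>lborel)
      \<longlonglongrightarrow> (\<integral>\<^sup>+z. ennreal ((cmod (f z))\<^sup>2 * k (cmod z)) \<partial>lborel)"
  proof (rule nn_integral_dominated_convergence)
    show "AE z in lborel. ennreal ((cmod (P N z))\<^sup>2 * k (cmod z)) \<le> ennreal (C\<^sup>2) * indicator (ball 0 r) z" for N
    proof (rule AE_I2)
      fix z :: complex
      show "ennreal ((cmod (P N z))\<^sup>2 * k (cmod z)) \<le> ennreal (C\<^sup>2) * indicator (ball 0 r) z"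
      proof (cases "cmod z < r")
        case True
        then have "(cmod (P N z))\<^sup>2 * k (cmod z) \<le> C\<^sup>2 * 1"
          using bound[OF True, of N] k[of z] by (intro mult_mono power_mono) auto
        then show ?thesis using True by (simp add: ennreal_leI)
      qed (simp add: k_def)
    qed
    show "(\<integral>\<^sup>+z. ennreal (C\<^sup>2) * indicator (ball (0::complex) r) z \<partial>lborel) < \<infinity>"
      using emeasure_lborel_ball_finite[of "0::complex" r]
      by (subst nn_integral_cmult_indicator) (auto simp: ennreal_mult_less_top)
    show "AE z in lborel. (\<lambda>N. ennreal ((cmod (P N z))\<^sup>2 * k (cmod z)))
        \<longlonglongrightarrow> ennreal ((cmod (f z))\<^sup>2 * k (cmod z))"
    proof (rule AE_I2)
      fix z :: complex
      show "(\<lambda>N. ennreal ((cmod (P N z))\<^sup>2 * k (cmod z))) \<longlonglongrightarrow> ennreal ((cmod (f z))\<^sup>2 * k (cmod z))"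
      proof (cases "cmod z < r")
        case True
        with r f[of z] have "(\<lambda>N. P N z) \<longlonglongrightarrow> f z"
          by (simp add: sums_def P_def)
        then show ?thesis by (intro tendsto_ennrealI tendsto_intros)
      qed (simp add: k_def)
    qed
  qed measurable
  then have "(\<lambda>m. ennreal ((cmod (u m))\<^sup>2) * ennreal (I m)) sums (\<integral>\<^sup>+z. ennreal ((cmod (f z))\<^sup>2 * k (cmod z)) \<partial>lborel)"
    unfolding PN sums_def .
  then show ?thesis
    unfolding Im[symmetric] unfolding hk by (simp add: sums_iff)
qed

text \<open>Continuity from below of the measure with density \<open>g\<close> carries results for
  radii below 1 to the whole disc. The shift \<open>k + 2\<close> makes every radius positive,
  starting from 1/2.\<close>

lemma nn_integral_unit_ball_eq_SUP:
  assumes [measurable]: "g \<in> borel_measurable borel"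
  shows "(\<integral>\<^sup>+z\<in>ball (0::complex) 1. g z \<partial>lborel)
    = (SUP k. \<integral>\<^sup>+z\<in>ball (0::complex) (1 - 1 / real (k + 2)). g z \<partial>lborel)"
    and "incseq (\<lambda>k. \<integral>\<^sup>+z\<in>ball (0::complex) (1 - 1 / real (k + 2)). g z \<partial>lborel)"
proof -
  let ?B = "\<lambda>k. ball (0::complex) (1 - 1 / real (k + 2))"
  have inc: "incseq ?B"
    by (intro incseq_SucI subset_ball) (simp add: field_simps)
  have UN: "(\<Union>k. ?B k) = ball 0 1"
  proof (intro equalityI subsetI)
    fix z :: complex assume "z \<in> ball 0 1"
    then have "0 < 1 - cmod z" by simp
    then obtain k where "inverse (real (Suc k)) < 1 - cmod z"
      using reals_Archimedean by blast
    moreover have "1 / real (k + 2) \<le> inverse (real (Suc k))"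
      by (simp add: field_simps)
    ultimately have "z \<in> ?B k" by simp
    then show "z \<in> (\<Union>k. ?B k)" by blast
  qed (auto intro: less_le_trans)
  have eq: "(\<integral>\<^sup>+z\<in>A. g z \<partial>lborel) = emeasure (density lborel g) A" if "A \<in> sets borel" for A
    using that by (simp add: emeasure_density)
  show "(\<integral>\<^sup>+z\<in>ball (0::complex) 1. g z \<partial>lborel) = (SUP k. \<integral>\<^sup>+z\<in>?B k. g z \<partial>lborel)"
    using SUP_emeasure_incseq[of ?B "density lborel g"] inc unfolding UN by (simp add: eq image_subset_iff)
  show "incseq (\<lambda>k. \<integral>\<^sup>+z\<in>?B k. g z \<partial>lborel)"
    using incseq_emeasure[of ?B "density lborel g"] inc by (simp add: eq image_subset_iff)
qed

text \<open>The identity on smaller discs passes to the limit by monotone convergence, first in the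
  integral and then in the sum, whose terms increase with the radius. Both sides may be
  infinite.\<close>

lemma nn_integral_weight3_density:
  fixes u :: "nat \<Rightarrow> complex"
  assumes [measurable]: "f \<in> borel_measurable borel"
    and f: "\<And>z. cmod z < 1 \<Longrightarrow> (\<lambda>m. u m * z ^ m) sums f z"
  shows "(\<integral>\<^sup>+z\<in>ball 0 1. ennreal (weight3_density f z) \<partial>lborel)
    = (\<Sum>m. ennreal ((cmod (u m))\<^sup>2 * (6 * pi / ((real m + 1) * (real m + 2) * (real m + 3) * (real m + 4)))))"
proof -
  define h where "h = (\<lambda>x::real. (1 - x\<^sup>2) ^ 3)"
  define r where "r = (\<lambda>k. 1 - 1 / real (k + 2))"
  define J where "J = (\<lambda>k m. \<integral>\<^sup>+z\<in>ball (0::complex) (r k). ennreal (cmod z ^ (2 * m) * h (cmod z)) \<partial>lborel)"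
  have h: "0 \<le> h x \<and> h x \<le> 1" if "0 \<le> x" "x < 1" for x
  proof -
    have "x\<^sup>2 \<le> 1" using that by (simp add: power_le_one)
    then show ?thesis by (auto simp: h_def intro!: power_le_one)
  qed
  have [measurable]: "h \<in> borel_measurable borel" unfolding h_def by measurable
  have [measurable]: "weight3_density f \<in> borel_measurable borel"
    unfolding weight3_density_def by measurable
  have weight: "weight3_density f z = (cmod (f z))\<^sup>2 * h (cmod z)" for z
    by (simp add: weight3_density_def h_def)
  have r: "0 < r k" "r k < 1" for k
    by (simp_all add: r_def)
  have J: "incseq (\<lambda>k. J k m)"
    "(SUP k. J k m) = ennreal (6 * pi / ((real m + 1) * (real m + 2) * (real m + 3) * (real m + 4)))" for m
  proof -
    have [measurable]: "(\<lambda>z::complex. ennreal (cmod z ^ (2 * m) * h (cmod z))) \<in> borel_measurable borel"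
      by measurable
    show "incseq (\<lambda>k. J k m)"
      unfolding J_def r_def by (rule nn_integral_unit_ball_eq_SUP(2)) measurable
    have "(SUP k. J k m) = (\<integral>\<^sup>+z\<in>ball (0::complex) 1. ennreal (cmod z ^ (2 * m) * h (cmod z)) \<partial>lborel)"
      unfolding J_def r_def by (rule nn_integral_unit_ball_eq_SUP(1)[symmetric]) measurable
    then show "(SUP k. J k m) = ennreal (6 * pi / ((real m + 1) * (real m + 2) * (real m + 3) * (real m + 4)))"
      unfolding h_def nn_integral_ball_moment .
  qed
  have "(\<integral>\<^sup>+z\<in>ball 0 1. ennreal (weight3_density f z) \<partial>lborel)
      = (SUP k. \<integral>\<^sup>+z\<in>ball 0 (r k). ennreal (weight3_density f z) \<partial>lborel)"
    unfolding r_def by (rule nn_integral_unit_ball_eq_SUP(1)) measurable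
  also have "\<dots> = (SUP k. \<Sum>m. ennreal ((cmod (u m))\<^sup>2) * J k m)"
    unfolding J_def weight
    by (intro SUP_cong refl nn_integral_power_series_ball f r h) measurable
  also have "\<dots> = (\<Sum>m. SUP k. ennreal ((cmod (u m))\<^sup>2) * J k m)"
  proof (rule ennreal_suminf_SUP_eq[symmetric])
    show "incseq (\<lambda>k. ennreal ((cmod (u m))\<^sup>2) * J k m)" for m
      using J(1)[of m] by (auto simp: incseq_def intro: mult_left_mono)
  qed
  also have "\<dots> = (\<Sum>m. ennreal ((cmod (u m))\<^sup>2 * (6 * pi / ((real m + 1) * (real m + 2) * (real m + 3) * (real m + 4)))))"
    by (simp only: SUP_mult_left_ennreal[symmetric] J(2) ennreal_mult'[symmetric] zero_le_power2)
  finally show ?thesis .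
qed

text \<open>Summability makes the nonnegative integral finite, hence a genuine Bochner integral. The
  constant 24 is the normalisation \<open>4 / pi\<close> times the factor \<open>6 * pi\<close> of
  the moments.\<close>

lemma norm3_power_series:
  fixes u :: "nat \<Rightarrow> complex"
  assumes [measurable]: "f \<in> borel_measurable borel"
    and hol: "f holomorphic_on ball 0 1"
    and f: "\<And>z. cmod z < 1 \<Longrightarrow> (\<lambda>m. u m * z ^ m) sums f z"
    and summ: "summable (\<lambda>m. (cmod (u m))\<^sup>2 / ((real m + 1) * (real m + 2) * (real m + 3) * (real m + 4)))"
  shows "f \<in> A23"
    and "norm3 f = sqrt (24 * (\<Sum>m. (cmod (u m))\<^sup>2 / ((real m + 1) * (real m + 2) * (real m + 3) * (real m + 4))))"
proof -
  define c where "c = (\<lambda>m. (cmod (u m))\<^sup>2 / ((real m + 1) * (real m + 2) * (real m + 3) * (real m + 4)))"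
  have [measurable]: "weight3_density f \<in> borel_measurable borel"
    unfolding weight3_density_def by measurable
  have [measurable]: "ball (0::complex) 1 \<in> sets borel"
    by simp
  have nonneg: "0 \<le> weight3_density f z" if "z \<in> ball 0 1" for z
    using that by (auto simp: weight3_density_def power_le_one)
  have c: "summable c" "0 \<le> c m" for m
    using summ by (auto simp: c_def)
  let ?g = "\<lambda>z. indicator (ball 0 1) z *\<^sub>R weight3_density f z"
  have "(\<integral>\<^sup>+z. ennreal (?g z) \<partial>lborel) = (\<integral>\<^sup>+z\<in>ball 0 1. ennreal (weight3_density f z) \<partial>lborel)"
    by (intro nn_integral_cong) (auto simp: indicator_def)
  also have "\<dots> = (\<Sum>m. ennreal ((cmod (u m))\<^sup>2 * (6 * pi / ((real m + 1) * (real m + 2) * (real m + 3) * (real m + 4)))))"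
    by (rule nn_integral_weight3_density) (auto intro: f)
  also have "\<dots> = (\<Sum>m. ennreal (6 * pi * c m))"
    by (simp add: c_def mult_ac)
  also have "\<dots> = ennreal (\<Sum>m. 6 * pi * c m)"
    using c by (intro suminf_ennreal_eq summable_sums summable_mult) auto
  also have "(\<Sum>m. 6 * pi * c m) = 6 * pi * suminf c"
    using c by (intro suminf_mult)
  finally have nn: "(\<integral>\<^sup>+z. ennreal (?g z) \<partial>lborel) = ennreal (6 * pi * suminf c)" .
  have g0: "0 \<le> ?g z" for z
    using nonneg[of z] by (auto simp: indicator_def)
  have bochner: "has_bochner_integral lborel ?g (6 * pi * suminf c)"
    using g0 c by (intro has_bochner_integral_nn_integral nn mult_nonneg_nonneg suminf_nonneg) auto
  \<comment> \<open>\<open>lebesgue\<close> is the completion of \<open>lborel\<close>, and the two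
    integrals agree on Borel functions.\<close>
  have "integrable lebesgue ?g"
    using bochner by (subst integrable_completion) (auto simp: has_bochner_integral_iff)
  with hol show "f \<in> A23"
    by (simp add: A23_def set_integrable_def)
  have "integral\<^sup>L lebesgue ?g = 6 * pi * suminf c"
    using bochner by (subst integral_completion) (auto simp: has_bochner_integral_iff)
  then have "norm3 f = sqrt (24 * suminf c)"
    by (simp add: norm3_def set_lebesgue_integral_def field_simps)
  then show "norm3 f = sqrt (24 * (\<Sum>m. (cmod (u m))\<^sup>2 / ((real m + 1) * (real m + 2) * (real m + 3) * (real m + 4))))"
    by (simp add: c_def)
qed

section \<open>The weights of the squared power sums\<close>

text \<open>The sequence \<open>c\<close> of the overview: a double pole contributes
  \<open>(m + 1)\<^sup>2\<close>, and one factor cancels against the denominator of the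
  moment.\<close>

definition pole_weight :: "nat \<Rightarrow> real" where
  "pole_weight m = (real m + 1) / ((real m + 2) * (real m + 3) * (real m + 4))"

lemma pole_weight_pos: "0 < pole_weight m"
  by (simp add: pole_weight_def)

lemma pole_weight_decreasing: "pole_weight (Suc m) < pole_weight m"
proof -
  have "(x + 2) / ((x + 3) * (x + 4) * (x + 5)) < (x + 1) / ((x + 2) * (x + 3) * (x + 4))" if "0 \<le> x" for x :: real
  proof -
    have "(x + 1) / ((x + 2) * (x + 3) * (x + 4)) - (x + 2) / ((x + 3) * (x + 4) * (x + 5))
      = (2 * x + 1) / ((x + 2) * (x + 3) * (x + 4) * (x + 5))"
    proof -
      have "x + 2 \<noteq> 0" "x + 3 \<noteq> 0" "x + 4 \<noteq> 0" "x + 5 \<noteq> 0" using that by auto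
      then show ?thesis by (simp add: divide_simps) (simp add: algebra_simps)
    qed
    also have "\<dots> > 0" using that by simp
    finally show ?thesis by simp
  qed
  from this[of "real m"] show ?thesis
    by (simp add: pole_weight_def add_ac)
qed

text \<open>The second difference is \<open>6 * m\<close> over the product of the factors from
  \<open>m + 2\<close> to \<open>m + 6\<close>. It vanishes at \<open>m = 0\<close>, so the
  inequality cannot be strict.\<close>

lemma pole_weight_convex: "2 * pole_weight (Suc m) \<le> pole_weight m + pole_weight (Suc (Suc m))"
proof -
  have "2 * ((x + 2) / ((x + 3) * (x + 4) * (x + 5))) \<le> (x + 1) / ((x + 2) * (x + 3) * (x + 4)) 
     + (x + 3) / ((x + 4) * (x + 5) * (x + 6))" if "0 \<le> x" for x :: real
  proof -
    have "(x + 1) / ((x + 2) * (x + 3) * (x + 4)) + (x + 3) / ((x + 4) * (x + 5) * (x + 6))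
        - 2 * ((x + 2) / ((x + 3) * (x + 4) * (x + 5)))
      = 6 * x / ((x + 2) * (x + 3) * (x + 4) * (x + 5) * (x + 6))"
    proof -
      have "x + 2 \<noteq> 0" "x + 3 \<noteq> 0" "x + 4 \<noteq> 0" "x + 5 \<noteq> 0" "x + 6 \<noteq> 0" using that by auto
      then show ?thesis by (simp add: divide_simps) (simp add: algebra_simps)
    qed
    also have "\<dots> \<ge> 0" using that by simp
    finally show ?thesis by simp
  qed
  from this[of "real m"] show ?thesis
    by (simp add: pole_weight_def add_ac)
qed


lemma summable_pole_weight: "summable pole_weight"
proof (rule summable_comparison_test')
  show "summable (\<lambda>m. inverse (real (Suc m) ^ 2))"
    by (subst summable_Suc_iff) (rule inverse_power_summable, simp)
  fix m :: nat
  have "pole_weight m \<le> (real m + 1) / ((real m + 1) * (real m + 1) * (real m + 1))"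
    unfolding pole_weight_def by (intro divide_left_mono mult_mono) auto
  also have "\<dots> = inverse (real (Suc m) ^ 2)"
    by (simp add: power2_eq_square inverse_eq_divide add.commute)
  finally show "norm (pole_weight m) \<le> inverse (real (Suc m) ^ 2)"
    using pole_weight_pos[of m] by simp
qed

section \<open>Simple partial fractions and power sums\<close>

text \<open>On the unit circle \<open>cnj a\<close> is the inverse of \<open>a\<close>, so the
  function is \<open>cnj a ^ 2 / (1 - cnj a * z)\<^sup>2\<close>, expanded by the derivative of the
  geometric series.\<close>

lemma inverse_square_power_series:
  fixes a z :: complex
  assumes "cmod a = 1" "cmod z < 1"
  shows "(\<lambda>m. of_nat (Suc m) * cnj a ^ (m + 2) * z ^ m) sums (1 / (z - a)\<^sup>2)"
proof -
  have aa: "a * cnj a = 1"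
    using assms(1) by (simp add: complex_norm_square[symmetric])
  have "(\<lambda>m. cnj a ^ 2 * (of_nat (Suc m) * (cnj a * z) ^ m)) sums (cnj a ^ 2 * (1 / (1 - cnj a * z)\<^sup>2))"
    using assms by (intro sums_mult geometric_deriv_sums) (simp add: norm_mult)
  also have "(\<lambda>m. cnj a ^ 2 * (of_nat (Suc m) * (cnj a * z) ^ m)) = (\<lambda>m. of_nat (Suc m) * cnj a ^ (m + 2) * z ^ m)"
    by (simp add: fun_eq_iff power_mult_distrib power_add power2_eq_square mult_ac)
  also have "cnj a ^ 2 * (1 / (1 - cnj a * z)\<^sup>2) = 1 / (z - a)\<^sup>2"
  proof -
    have "cnj a * (z - a) = - (1 - cnj a * z)"
      using aa by (simp add: algebra_simps)
    then have "(1 - cnj a * z)\<^sup>2 = cnj a ^ 2 * (z - a)\<^sup>2"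
      by (metis power2_minus power_mult_distrib)
    moreover have "cnj a \<noteq> 0" using aa by auto
    ultimately show ?thesis by simp
  qed
  finally show ?thesis .
qed

text \<open>The Taylor coefficient of index \<open>m\<close> is \<open>m + 1\<close> times the
  conjugate of the power sum of exponent \<open>m + 2\<close>; the power sums are bounded by
  \<open>n\<close>.\<close>

lemma norm3_simple_partial_fraction2:
  assumes a: "\<And>k. k < n \<Longrightarrow> cmod (a k) = 1"
  shows "simple_partial_fraction2 n a \<in> A23"
    and "summable (\<lambda>m. pole_weight m * (cmod (\<Sum>k<n. a k ^ (m + 2)))\<^sup>2)"
    and "norm3 (simple_partial_fraction2 n a)
      = sqrt (24 * (\<Sum>m. pole_weight m * (cmod (\<Sum>k<n. a k ^ (m + 2)))\<^sup>2))"
proof -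
  define u where "u = (\<lambda>m. of_nat (Suc m) * cnj (\<Sum>k<n. a k ^ (m + 2)))"
  have eq: "(cmod (u m))\<^sup>2 / ((real m + 1) * (real m + 2) * (real m + 3) * (real m + 4))
      = pole_weight m * (cmod (\<Sum>k<n. a k ^ (m + 2)))\<^sup>2" for m
  proof -
    have "cmod (u m) = (real m + 1) * cmod (\<Sum>k<n. a k ^ (m + 2))"
      unfolding u_def norm_mult complex_mod_cnj norm_of_nat by (simp only: of_nat_Suc add.commute)
    then have "(cmod (u m))\<^sup>2 = (real m + 1) * ((real m + 1) * (cmod (\<Sum>k<n. a k ^ (m + 2)))\<^sup>2)"
      by (simp only: power_mult_distrib power2_eq_square mult_ac)
    then show ?thesis
      by (simp add: pole_weight_def)
  qed
  have "cmod (\<Sum>k<n. a k ^ (m + 2)) \<le> (\<Sum>k<n. 1)" for m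
    using a by (intro order.trans[OF norm_sum] sum_mono) (simp add: norm_mult norm_power)
  then have le: "(cmod (\<Sum>k<n. a k ^ (m + 2)))\<^sup>2 \<le> (real n)\<^sup>2" for m
    by (intro power_mono) auto
  show summ: "summable (\<lambda>m. pole_weight m * (cmod (\<Sum>k<n. a k ^ (m + 2)))\<^sup>2)"
  proof (rule summable_comparison_test')
    show "summable (\<lambda>m. pole_weight m * (real n)\<^sup>2)"
      by (intro summable_mult2 summable_pole_weight)
    show "norm (pole_weight m * (cmod (\<Sum>k<n. a k ^ (m + 2)))\<^sup>2) \<le> pole_weight m * (real n)\<^sup>2" for m
      using le[of m] pole_weight_pos[of m] by (simp add: abs_mult mult_left_mono)
  qed
  have sums: "(\<lambda>m. u m * z ^ m) sums simple_partial_fraction2 n a z" if "cmod z < 1" for z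
  proof -
    have "(\<lambda>m. \<Sum>k<n. of_nat (Suc m) * cnj (a k) ^ (m + 2) * z ^ m) sums (\<Sum>k<n. 1 / (z - a k)\<^sup>2)"
      using that a by (intro sums_sum inverse_square_power_series) auto
    then show ?thesis
      by (simp add: u_def simple_partial_fraction2_def sum_distrib_left sum_distrib_right)
  qed
  have meas: "simple_partial_fraction2 n a \<in> borel_measurable borel"
    unfolding simple_partial_fraction2_def by measurable
  have hol: "simple_partial_fraction2 n a holomorphic_on ball 0 1"
    unfolding simple_partial_fraction2_def using a by (intro holomorphic_intros) auto
  show "simple_partial_fraction2 n a \<in> A23"
    using summ by (intro norm3_power_series(1)[OF meas hol, of u] sums) (simp_all add: eq)
  show "norm3 (simple_partial_fraction2 n a)
      = sqrt (24 * (\<Sum>m. pole_weight m * (cmod (\<Sum>k<n. a k ^ (m + 2)))\<^sup>2))"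
    unfolding eq[symmetric] using summ by (intro norm3_power_series(2)[OF meas hol] sums) (simp_all add: eq)
qed

lemma cmod_equidistributed: "cmod (equidistributed n k) = 1"
proof -
  have "equidistributed n k = exp (\<i> * complex_of_real (2 * pi * real k / real n))"
    by (simp add: equidistributed_def mult_ac)
  then show ?thesis by simp
qed

text \<open>Exchanging the roles of \<open>j\<close> and \<open>k\<close> makes this a geometric sum
  whose ratio is an \<open>n\<close>-th root of unity, equal to 1 exactly when \<open>n\<close>
  divides \<open>j\<close>.\<close>

lemma sum_equidistributed_power:
  assumes "n > 0"
  shows "(\<Sum>k<n. equidistributed n k ^ j) = (if n dvd j then of_nat n else 0)"
proof -
  define w where "w = exp (2 * complex_of_real pi * \<i> * of_nat j / of_nat n)"
  have w: "w = 1 \<longleftrightarrow> n dvd j"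
    using complex_root_unity_eq_1[of n j] assms by (simp add: w_def)
  have "w ^ n = 1"
    unfolding w_def by (rule complex_root_unity) (use assms in simp)
  have "equidistributed n k ^ j = w ^ k" for k
    unfolding equidistributed_def w_def exp_of_nat_mult[symmetric] by (simp add: mult_ac)
  then have "(\<Sum>k<n. equidistributed n k ^ j) = (\<Sum>k<n. w ^ k)"
    by simp
  also have "\<dots> = (if n dvd j then of_nat n else 0)"
    using w \<open>w ^ n = 1\<close> by (auto simp: geometric_sum)
  finally show ?thesis .
qed

section \<open>Comparison of the two norm series\<close>

text \<open>Meant for coefficients of period \<open>p\<close> with changing signs: a convergent
  series may be summed in blocks, and the first block bounds the total from below.\<close>

lemma suminf_greater_by_blocks:
  fixes f :: "nat \<Rightarrow> real"
  assumes "summable f" "0 < p"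
    and nonneg: "\<And>l. 0 \<le> (\<Sum>i<p. f (l * p + i))"
    and pos: "c < (\<Sum>i<p. f i)"
  shows "c < suminf f"
proof -
  have "(\<lambda>l. sum f {l * p..<l * p + p}) sums suminf f"
    using assms by (intro sums_group summable_sums) auto
  then have s: "(\<lambda>l. \<Sum>i<p. f (l * p + i)) sums suminf f"
    by (simp add: sum.atLeastLessThan_shift_0[of f] lessThan_atLeast0 comp_def)
  have "(\<Sum>i<p. f i) = (\<Sum>l<1. \<Sum>i<p. f (l * p + i))"
    by simp
  also have "\<dots> \<le> (\<Sum>l. \<Sum>i<p. f (l * p + i))"
    using s nonneg by (intro sum_le_suminf) (auto simp: sums_iff)
  finally show ?thesis
    using pos s by (simp add: sums_iff)
qed

text \<open>For odd \<open>j\<close> the sign is left open because the moduli of both power sums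
  needed later do not depend on it.\<close>

lemma power_ii_cases:
  fixes j :: nat
  obtains "4 dvd j" "even j" "\<i> ^ j = 1"
  | "\<not> 4 dvd j" "even j" "\<i> ^ j = -1"
  | "\<not> 4 dvd j" "odd j" "\<i> ^ j = \<i> \<or> \<i> ^ j = -\<i>"
proof -
  have "\<i> ^ j = (\<i> ^ 4) ^ (j div 4) * \<i> ^ (j mod 4)"
    by (metis mult_div_mod_eq power_add power_mult)
  also have "\<i> ^ 4 = (1::complex)" by simp
  finally have *: "\<i> ^ j = \<i> ^ (j mod 4)" by simp
  have "j mod 4 = 0 \<and> 4 dvd j \<and> even j \<or> j mod 4 = 1 \<and> \<not> 4 dvd j \<and> odd j
    \<or> j mod 4 = 2 \<and> \<not> 4 dvd j \<and> even j \<or> j mod 4 = 3 \<and> \<not> 4 dvd j \<and> odd j"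
    by presburger
  then show thesis
    by (elim disjE conjE) (use * that in \<open>simp_all add: power3_eq_cube\<close>)
qed

text \<open>The last premise may assume summability, which follows here from that of the two norm
  series. For each configuration only the positivity of the difference remains.\<close>

lemma norm3_less_equidistributed:
  assumes "\<And>k. k < n \<Longrightarrow> cmod (a k) = 1" "n > 0"
    and A: "\<And>m. (cmod (\<Sum>k<n. a k ^ m))\<^sup>2 = A m"
    and "summable (\<lambda>m. pole_weight m * ((if n dvd m + 2 then (real n)\<^sup>2 else 0) - A (m + 2))) \<Longrightarrow> 
      0 < (\<Sum>m. pole_weight m * ((if n dvd m + 2 then (real n)\<^sup>2 else 0) - A (m + 2)))"
  shows "norm3 (simple_partial_fraction2 n a) < norm3 (simple_partial_fraction2 n (equidistributed n))"
proof -
  have e: "(cmod (\<Sum>k<n. equidistributed n k ^ m))\<^sup>2 = (if n dvd m then (real n)\<^sup>2 else 0)" for m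
    using sum_equidistributed_power[OF \<open>n > 0\<close>, of m] by simp
  note sa = norm3_simple_partial_fraction2[of n a, unfolded A, OF assms(1)]
  note se = norm3_simple_partial_fraction2[of n "equidistributed n", unfolded e, OF cmod_equidistributed]
  have "(\<Sum>m. pole_weight m * ((if n dvd m + 2 then (real n)\<^sup>2 else 0) - A (m + 2)))
     = (\<Sum>m. pole_weight m * (if n dvd m + 2 then (real n)\<^sup>2 else 0)) - (\<Sum>m. pole_weight m * A (m + 2))"
    unfolding right_diff_distrib by (rule suminf_diff[symmetric]) (rule se sa, assumption?)+
  moreover have "summable (\<lambda>m. pole_weight m * ((if n dvd m + 2 then (real n)\<^sup>2 else 0) - A (m + 2)))"
    unfolding right_diff_distrib by (rule summable_diff) (rule se sa, assumption?)+
  ultimately show ?thesis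
    using assms(4) by (simp add: sa se)
qed

text \<open>From \<open>j = 2\<close> on, the coefficients repeat 4, -2, 0, -2. Each block is twice
  the sum of the drops of \<open>pole_weight\<close> from \<open>k\<close> to \<open>k + 1\<close>
  and from \<open>k\<close> to \<open>k + 3\<close>, hence positive.\<close>

lemma two_points_series_pos:
  defines "e \<equiv> \<lambda>j. (if 2 dvd j then 4 else 0) - (if 4 dvd j then 4 else if even j then 0 else 2)"
  assumes "summable (\<lambda>m. pole_weight m * e (m + 2))"
  shows "0 < (\<Sum>m. pole_weight m * e (m + 2))"
proof (rule suminf_greater_by_blocks[OF assms(2), of 4])
  have periodic: "e (l * 4 + i + 2) = e (i + 2)" for l i
  proof -
    have "4 dvd l * 4 + i + 2 \<longleftrightarrow> 4 dvd i + 2" "2 dvd l * 4 + i + 2 \<longleftrightarrow> 2 dvd i + 2"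
      by presburger+
    then show ?thesis
      by (simp only: e_def)
  qed
  have "{..<4} = {0, 1, 2, 3 :: nat}"
    by auto
  moreover have "e 2 = 4" "e 3 = -2" "e 4 = 0" "e 5 = -2"
    by (simp_all add: e_def)
  ultimately have block: "(\<Sum>i<4. pole_weight (k + i) * e (i + 2)) = 4 * pole_weight k - 2 * pole_weight (k + 1) - 2 * pole_weight (k + 3)" for k
    by (simp del: One_nat_def add_2_eq_Suc add_2_eq_Suc')
  have pos: "0 < (\<Sum>i<4. pole_weight (k + i) * e (i + 2))" for k
    unfolding block using pole_weight_decreasing[of k] pole_weight_decreasing[of "k+1"] pole_weight_decreasing[of "k+2"]
    by (simp add: eval_nat_numeral)
  show "0 \<le> (\<Sum>i<4. pole_weight (l * 4 + i) * e (l * 4 + i + 2))" for l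
    unfolding periodic by (rule less_imp_le[OF pos])
  show "0 < (\<Sum>i<4. pole_weight i * e (i + 2))"
    using pos[of 0] by simp
qed simp

text \<open>
  The term \<open>j = 2\<close> is split off so that the first and second partial sums of the remaining coefficients
  \<open>8, -9, -1, 8, -1, -9, 8, -1, -1, 0, -1, -1\<close> of a period behave well: the first sum to \<open>0\<close> and the second
  are all positive. Summing by parts twice, convexity then makes every block nonnegative.
\<close>

lemma three_points_series_pos:
  defines "e \<equiv> \<lambda>j. (if 3 dvd j then 9 else 0) - (if 4 dvd j then 9 else 1)"
  assumes "summable (\<lambda>m. pole_weight m * e (m + 2))"
  shows "0 < (\<Sum>m. pole_weight m * e (m + 2))"
proof -
  \<comment> \<open>The period 12 is the least common multiple of 3 and 4; blocks start at
    \<open>j = 3\<close>.\<close>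
  have periodic: "e (l * 12 + i + 3) = e (i + 3)" for l i
  proof -
    have "4 dvd l * 12 + i + 3 \<longleftrightarrow> 4 dvd i + 3" "3 dvd l * 12 + i + 3 \<longleftrightarrow> 3 dvd i + 3"
      by presburger+
    then show ?thesis
      by (simp only: e_def)
  qed
  have "{..<12} = {0, 1, 2, 3, 4, 5, 6, 7, 8, 9, 10, 11 :: nat}"
    by (rule set_eqI) (simp, presburger)
  moreover have "e 3 = 8" "e 4 = -9" "e 5 = -1" "e 6 = 8" "e 7 = -1" "e 8 = -9" "e 9 = 8" "e 10 = -1"
    "e 11 = -1" "e 12 = 0" "e 13 = -1" "e 14 = -1"
    by (simp_all add: e_def)
  ultimately have block: "(\<Sum>i<12. q i * e (i + 3)) = 8 * q 0 - 9 * q 1 - q 2 + 8 * q 3 - q 4 - 9 * q 5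
      + 8 * q 6 - q 7 - q 8 - q 10 - q 11" for q :: "nat \<Rightarrow> real"
    by (simp del: One_nat_def add_2_eq_Suc add_2_eq_Suc')
  have nonneg: "0 \<le> (\<Sum>i<12. pole_weight (k + i + 1) * e (i + 3))" for k
  proof -
    define q where "q = (\<lambda>i. pole_weight (k + i + 1))"
    have convex: "2 * q (i + 1) \<le> q i + q (i + 2)" for i
      using pole_weight_convex[of "k + i + 1"] by (simp add: q_def)
    \<comment> \<open>Since the coefficients sum to 0, two summations by parts leave second
      differences with positive factors and the boundary term \<open>24 * (q 10 - q 11)\<close>,
      which needs monotonicity.\<close>
    have "q 11 \<le> q 10"
      using pole_weight_decreasing[of "k + 11"] by (simp add: q_def eval_nat_numeral)
    then have "0 \<le> (\<Sum>i<12. q i * e (i + 3))"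
      unfolding block
      using convex[of 0] convex[of 1] convex[of 2] convex[of 3] convex[of 4] convex[of 5]
        convex[of 6] convex[of 7] convex[of 8] convex[of 9]
      by (simp del: One_nat_def add_2_eq_Suc add_2_eq_Suc')
    then show ?thesis
      by (simp only: q_def)
  qed
  have "pole_weight 0 < (\<Sum>m. pole_weight (m + 1) * e (m + 3))"
  proof (rule suminf_greater_by_blocks[of _ 12])
    show "summable (\<lambda>m. pole_weight (m + 1) * e (m + 3))"
      using assms(2) by (subst (asm) summable_iff_shift[of _ 1, symmetric]) (simp add: numeral_3_eq_3)
    show "0 \<le> (\<Sum>i<12. pole_weight (l * 12 + i + 1) * e (l * 12 + i + 3))" for l
      unfolding periodic by (rule nonneg)
    \<comment> \<open>The separated term \<open>j = 2\<close> is \<open>- pole_weight 0\<close>. The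
      first block outweighs it by explicit evaluation.\<close>
    show "pole_weight 0 < (\<Sum>i<12. pole_weight (i + 1) * e (i + 3))"
      unfolding block by (simp add: pole_weight_def)
  qed simp
  moreover have "(\<Sum>m. pole_weight m * e (m + 2)) = (\<Sum>m. pole_weight (m + 1) * e (m + 3)) - pole_weight 0"
  proof -
    have "e 2 = -1" by (simp add: e_def)
    then show ?thesis
      using suminf_split_head[OF assms(2)] by (simp add: numeral_2_eq_2 numeral_3_eq_3)
  qed
  ultimately show ?thesis
    by simp
qed

theorem mainTheorem7:
  fixes n :: nat
  assumes "n = 2 \<or> n = 3"
  shows "\<exists>a :: nat \<Rightarrow> complex.
           inj_on a {..<n} \<and> (\<forall>k<n. a k \<in> sphere 0 1) \<and>
           simple_partial_fraction2 n a \<in> A23 \<and>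
           simple_partial_fraction2 n (equidistributed n) \<in> A23 \<and>
           norm3 (simple_partial_fraction2 n a)
             < norm3 (simple_partial_fraction2 n (equidistributed n))"
proof -
  \<comment> \<open>One function serves both cases: for \<open>n = 2\<close> only 1 and
    \<open>\<i>\<close> are used. All values are fourth roots of unity, so the power sums have
    period 4.\<close>
  define a where "a = (\<lambda>k::nat. if k = 0 then 1 else if k = 1 then \<i> else - \<i>)"
  have inj: "inj_on a {..<n}"
    using assms by (auto simp: inj_on_def a_def complex_eq_iff)
  have unit: "cmod (a k) = 1" for k
    by (simp add: a_def)
  have sets: "{..<2} = {0, 1 :: nat}" "{..<3} = {0, 1, 2 :: nat}"
    by auto
  have minus: "(- \<i>) ^ j = (if even j then \<i> ^ j else - (\<i> ^ j))" for j
    by simp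
  have "norm3 (simple_partial_fraction2 n a) < norm3 (simple_partial_fraction2 n (equidistributed n))"
    using assms
  proof
    assume n: "n = 2"
    have "(cmod (\<Sum>k<2. a k ^ j))\<^sup>2 = (if 4 dvd j then 4 else if even j then 0 else 2)" for j
    proof -
      have "(\<Sum>k<2. a k ^ j) = 1 + \<i> ^ j"
        by (simp add: sets a_def)
      then show ?thesis
        by (cases rule: power_ii_cases[of j]) (auto simp: cmod_def)
    qed
    note A = this
    have sq: "(real 2)\<^sup>2 = 4"
      by simp
    show ?thesis
      unfolding n by (rule norm3_less_equidistributed[OF unit _ A], simp, unfold sq, rule two_points_series_pos)
  next
    assume n: "n = 3"
    have "(cmod (\<Sum>k<3. a k ^ j))\<^sup>2 = (if 4 dvd j then 9 else 1)" for j
    proof -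
      have "(\<Sum>k<3. a k ^ j) = 1 + \<i> ^ j + (- \<i>) ^ j"
        by (simp add: sets a_def)
      then show ?thesis
        unfolding minus by (cases rule: power_ii_cases[of j]) auto
    qed
    note A = this
    have sq: "(real 3)\<^sup>2 = 9"
      by simp
    show ?thesis
      unfolding n by (rule norm3_less_equidistributed[OF unit _ A], simp, unfold sq, rule three_points_series_pos)
  qed
  with inj unit show ?thesis
    by (intro exI[of _ a]) (auto intro!: norm3_simple_partial_fraction2(1) cmod_equidistributed)
qed

end
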